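(* For all integers $n,k$ with $0\le k<n$, $$o(n,k)=\sum_{k\le m\le n}\binom{n+1}{m+1}\,z(m,k)\,\frac{m-k}{n-k}\,(n-k)^{(n-m)},$$ and $o(n,n)=(2n-1)!!$ for all $n\ge 0$. Here $o(n,k)$ is the number of ordered labeled trees on $\{0,1,\dots,n\}$ whose maximal decreasing subtree has exactly $k$ edges, and $z(m,k)$ is the number of ordered labeled trees on $\{0,1,\dots,m\}$ that consist of a decreasing tree with $k$ edges together with $m-k$ additional increasing leaves attached to it.
   Context: An ordered tree is a rooted tree in which the children of each vertex are linearly ordered. An ordered labeled tree on $[0,n]:=\{0,1,\dots,n\}$ is an ordered tree whose vertex set is $[0,n]$ (so it has $n+1$ vertices; any vertex may be the root). An edge from a parent $u$ to a child $v$ is decreasing if $u>v$ and increasing if $u<v$. A tree is decreasing if all its edges are decreasing. The maximal decreasing subtree $\mathrm{MD}(T)$ of an ordered labeled tree $T$ is the maximal ordered subtree containing the root of $T$ all of whose edges are decreasing; that is, its vertices are exactly those $v$ such that every edge on the path from the root to $v$ is decreasing (the root included). $\mathcal{O}_{n,k}$ is the set of ordered labeled trees $T$ on $[0,n]$ such that $\mathrm{MD}(T)$ has exactly $k$ edges (equivalently $k+1$ vertices), and $o(n,k)=|\mathcal{O}_{n,k}|$. $\mathcal{Z}_{n,k}$ is the set of ordered labeled trees on $[0,n]$ obtained from a decreasing tree with $k$ edges by attaching $n-k$ additional increasing leaves; that is, the set of ordered labeled trees $T$ on $[0,n]$ such that $\mathrm{MD}(T)$ has exactly $k$ edges and each of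 the $n-k$ vertices not in $\mathrm{MD}(T)$ is a leaf of $T$ whose parent lies in $\mathrm{MD}(T)$ (and hence has a smaller label than the leaf). $z(n,k)=|\mathcal{Z}_{n,k}|$. $x^{(j)}:=x(x+1)\cdots(x+j-1)$ is the rising factorial, with $x^{(0)}=1$. $(2n-1)!!:=(2n-1)(2n-3)\cdots 3\cdot 1$, with $(-1)!!=1$. *)

theory Defs
  imports Complex_Main
begin

datatype 'a otree = Node (root: 'a) (children: "'a otree list")

fun labels :: "'a otree \<Rightarrow> 'a list" where
  "labels (Node a ts) = a # concat (map labels ts)"

definition verts :: "'a otree \<Rightarrow> 'a set" where
  "verts T = set (labels T)"

text \<open>All edges of the tree as pairs (parent, child).\<close>

fun edges :: "'a otree \<Rightarrow> ('a \<times> 'a) list" where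
  "edges (Node a ts) = map (\<lambda>t. (a, root t)) ts @ concat (map edges ts)"

definition ordered_labeled_trees :: "nat \<Rightarrow> nat otree set" where
  "ordered_labeled_trees n = {T. distinct (labels T) \<and> verts T = {0..n}}"

text \<open>The maximal decreasing subtree \<open>MD(T)\<close>: starting at the root, every subtree hanging
  from an increasing edge is cut off, so that a vertex survives iff all edges on
  the path from the root to it are decreasing.\<close>

fun MD :: "nat otree \<Rightarrow> nat otree" where
  "MD (Node a ts) = Node a (map MD (filter (\<lambda>t. root t < a) ts))"

definition is_leaf :: "'a otree \<Rightarrow> 'a \<Rightarrow> bool" where
  "is_leaf T v \<longleftrightarrow> v \<in> verts T \<and> (\<forall>w. (v, w) \<notin> set (edges T))"

definition O_set :: "nat \<Rightarrow> nat \<Rightarrow> nat otree set" where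
  "O_set n k = {T \<in> ordered_labeled_trees n. length (edges (MD T)) = k}"

definition Z_set :: "nat \<Rightarrow> nat \<Rightarrow> nat otree set" where
  "Z_set n k = {T \<in> ordered_labeled_trees n. length (edges (MD T)) = k \<and>
     (\<forall>v \<in> verts T - verts (MD T).
        is_leaf T v \<and> (\<exists>u \<in> verts (MD T). (u, v) \<in> set (edges T)))}"

definition o_num :: "nat \<Rightarrow> nat \<Rightarrow> nat" where
  "o_num n k = card (O_set n k)"

definition z_num :: "nat \<Rightarrow> nat \<Rightarrow> nat" where
  "z_num n k = card (Z_set n k)"

text \<open>\<open>(2n-1)!!\<close>, the product of the first \<open>n\<close> odd numbers; the empty product gives \<open>(-1)!! = 1\<close>.\<close>

definition odd_double_fact :: "nat \<Rightarrow> nat" where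
  "odd_double_fact n = (\<Prod>i=1..n. 2 * i - 1)"

end

theory Submission
  imports Defs "HOL-Library.Multiset" "HOL-Library.Infinite_Set"
begin

text \<open>Cut a tree \<open>T\<close> along the increasing edges that leave \<open>MD(T)\<close>. What remains, together with
  the roots of the cut-off subtrees kept as leaves, is a tree counted by \<open>z(m,k)\<close> after an
  order-preserving relabeling, and the cut-off subtrees form a forest with \<open>r = m - k\<close>
  prescribed roots and \<open>q = n - m\<close> further vertices, without any restriction on its edges.
  The number \<open>f(r,q)\<close> of such forests satisfies
  \<open>f(r,q) = f(r-1,q) + q f(r+1,q-1)\<close>, according to whether the first root is a leaf or has a first
  child, and this recurrence is solved by \<open>r/(r+q) (r+q)\<^sup>(\<^sup>q\<^sup>)\<close>. Decreasing trees are counted by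
  inserting the labels in decreasing order: the minimal label is a leaf, and a forest with \<open>j\<close>
  vertices has \<open>2j + 1\<close> places for a new leaf.\<close>

section \<open>Forests with prescribed roots\<close>

abbreviation forest_labels :: "'a otree list \<Rightarrow> 'a list" where
  "forest_labels ts \<equiv> concat (map labels ts)"

text \<open>A multiset equation takes the place of distinctness and disjointness conditions. It
  still makes sense when labels in \<open>as\<close> repeat or lie in \<open>R\<close>, so the
  recursion below carries no side conditions.\<close>

definition rooted_forests :: "'a list \<Rightarrow> 'a set \<Rightarrow> 'a otree list set" where
  "rooted_forests as R =
     {ts. map root ts = as \<and> mset (forest_labels ts) = mset as + mset_set R}"

text \<open>Undoes the detaching of a first child: the leading tree returns below the root that
  follows it. The second equation is a default for lists that do not have this shape.\<close>

fun adopt_first :: "'a otree list \<Rightarrow> 'a otree list" where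
  "adopt_first (t # Node a us # ts) = Node a (t # us) # ts"
| "adopt_first ts = ts"

text \<open>The case \<open>r + q = 0\<close> is set apart because the empty forest counts once,
  whereas the fraction would evaluate to 0.\<close>

definition forest_count :: "nat \<Rightarrow> nat \<Rightarrow> real" where
  "forest_count r q =
     (if r + q = 0 then 1 else real r / real (r + q) * pochhammer (real (r + q)) q)"

lemma labels_neq_Nil [simp]: "labels T \<noteq> []"
  by (cases T) simp

lemma root_in_labels [simp]: "root T \<in> set (labels T)"
  by (cases T) simp

lemma mset_roots_subseteq: "mset (map root ts) \<subseteq># mset (forest_labels ts)"
proof (induction ts)
  case (Cons t ts)
  then show ?case by (cases t) (auto intro: subset_mset.add_increasing)
qed simp

lemma forest_count_0_left: "forest_count 0 q = (if q = 0 then 1 else 0)"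
  by (simp add: forest_count_def)

lemma forest_count_0_right: "forest_count r 0 = 1"
  by (simp add: forest_count_def)

text \<open>All three terms are multiples of \<open>P = pochhammer y p\<close> with
  \<open>y = r + p + 2\<close>. After cancelling \<open>P / y\<close> the claim is the polynomial
  identity \<open>(r + 1) * (y + p) = r * y + (p + 1) * (r + 2)\<close>.\<close>

lemma forest_count_Suc:
  "forest_count (Suc r) (Suc p) =
     forest_count r (Suc p) + real (Suc p) * forest_count (Suc (Suc r)) p"
proof -
  define y where "y = real r + real p + 2"
  define P where "P = pochhammer y p"
  have y: "y > 0" "y - 1 > 0" by (simp_all add: y_def)
  have 1: "forest_count (Suc r) (Suc p) = (real r + 1) / y * (P * (y + real p))"
    by (simp add: forest_count_def pochhammer_rec' P_def y_def algebra_simps)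
  have "forest_count r (Suc p) = real r / (y - 1) * pochhammer (y - 1) (Suc p)"
    by (simp add: forest_count_def y_def algebra_simps)
  also have "\<dots> = real r * P"
    using y by (simp add: pochhammer_rec P_def)
  finally have 2: "forest_count r (Suc p) = real r * P" .
  have 3: "forest_count (Suc (Suc r)) p = (real r + 2) / y * P"
    by (simp add: forest_count_def P_def y_def algebra_simps)
  have "(real r + 1) * (y + real p) = real r * y + (real p + 1) * (real r + 2)"
    by (simp add: y_def algebra_simps)
  hence "(real r + 1) / y * (P * (y + real p)) =
      (real r * y + (real p + 1) * (real r + 2)) * P / y"
    by (metis (no_types, opaque_lifting) mult.assoc mult.commute times_divide_eq_left)
  also have "\<dots> = real r * P + real (Suc p) * ((real r + 2) / y * P)"
    using y(1) by (simp add: field_simps)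
  finally show ?thesis by (simp only: 1 2 3)
qed

lemma rooted_forests_Nil:
  "finite R \<Longrightarrow> rooted_forests [] R = (if R = {} then {[]} else {})"
  by (auto simp: rooted_forests_def mset_set_empty_iff)

lemma rooted_forests_Cons_Cons_shape:
  assumes "ss \<in> rooted_forests (c # a # as) R"
  shows "\<exists>t us vs. ss = t # Node a us # vs \<and> root t = c"
proof -
  have "map root ss = c # a # as" using assms by (simp add: rooted_forests_def)
  then obtain t s vs where "ss = t # s # vs" "root t = c" "root s = a"
    by (auto simp: map_eq_Cons_conv)
  then show ?thesis by (metis otree.collapse)
qed

text \<open>The first root is either a leaf, or its first subtree can be detached and put in front
  of the forest.\<close>

lemma rooted_forests_Cons:
  assumes "finite R"
  shows "rooted_forests (a # as) R =
    (#) (Node a []) ` rooted_forests as R \<union>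
    (\<Union>c\<in>R. adopt_first ` rooted_forests (c # a # as) (R - {c}))" (is "?L = ?A \<union> ?B")
proof (intro equalityI subsetI)
  fix ts assume ts: "ts \<in> ?L"
  then obtain us vs where ts_eq: "ts = Node a us # vs"
    unfolding rooted_forests_def by (cases ts; cases "hd ts") auto
  show "ts \<in> ?A \<union> ?B"
  proof (cases us)
    case Nil
    then have "vs \<in> rooted_forests as R" using ts ts_eq by (auto simp: rooted_forests_def)
    then show ?thesis using Nil ts_eq by blast
  next
    case (Cons t us')
    have eq: "mset (labels t) + mset (forest_labels us') + mset (forest_labels vs)
        = mset as + mset_set R" and roots: "map root vs = as"
      using ts unfolding ts_eq Cons rooted_forests_def by (auto simp: add.assoc)
    obtain ls where ls: "labels t = root t # ls" by (cases t) auto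
    \<comment> \<open>\<open>M\<close> holds the non-root labels of the remaining trees. Since
      \<open>as\<close> may share labels with \<open>R\<close>, membership of \<open>root t\<close>
      in \<open>R\<close> is obtained by cancelling \<open>as\<close> in the multiset
      equation.\<close>
    obtain M where M: "mset (forest_labels vs) = mset as + M"
      using mset_roots_subseteq[of vs] unfolding roots by (auto simp: subset_mset.le_iff_add)
    have R_eq: "mset_set R = add_mset (root t) (mset ls + mset (forest_labels us') + M)"
      using eq unfolding ls M by (simp add: ac_simps)
    have rt: "root t \<in> R" using R_eq assms by (metis elem_mset_set union_single_eq_member)
    have "mset_set R = add_mset (root t) (mset_set (R - {root t}))"
      using assms rt by (simp add: mset_set.remove)
    hence "mset_set (R - {root t}) = mset ls + mset (forest_labels us') + M"
      using R_eq by simp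
    hence "t # Node a us' # vs \<in> rooted_forests (root t # a # as) (R - {root t})"
      using roots ls M by (simp add: rooted_forests_def ac_simps)
    then have "ts \<in> ?B" using rt unfolding ts_eq Cons
      by (auto intro!: bexI[of _ "root t"] image_eqI[where x = "t # Node a us' # vs"])
    then show ?thesis ..
  qed
next
  fix ts assume "ts \<in> ?A \<union> ?B"
  then show "ts \<in> ?L"
  proof
    assume "ts \<in> ?A"
    then show ?thesis by (auto simp: rooted_forests_def)
  next
    assume "ts \<in> ?B"
    then obtain c ss where c: "c \<in> R" "ss \<in> rooted_forests (c # a # as) (R - {c})"
      "ts = adopt_first ss" by auto
    then obtain t us vs where ss: "ss = t # Node a us # vs"
      using rooted_forests_Cons_Cons_shape[OF c(2)] by blast
    have "mset_set R = add_mset c (mset_set (R - {c}))"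
      using assms c(1) by (simp add: mset_set.remove)
    then show ?thesis using c ss by (auto simp: rooted_forests_def ac_simps)
  qed
qed

text \<open>Both cases of the recursion lower \<open>2 * q + r\<close> by one: a leaf root is
  dropped, or a non-root vertex becomes a root, which replaces \<open>(r, q)\<close> by
  \<open>(r + 1, q - 1)\<close>. This explains the induction measure.\<close>

lemma card_rooted_forests:
  assumes "finite R"
  shows "finite (rooted_forests as R) \<and>
    real (card (rooted_forests as R)) = forest_count (length as) (card R)"
  using assms
proof (induction "2 * card R + length as" arbitrary: as R rule: less_induct)
  case less
  show ?case
  proof (cases as)
    case Nil
    then show ?thesis using less.prems
      by (auto simp: rooted_forests_Nil forest_count_0_left)
  next
    case (Cons a bs)
    let ?A = "(#) (Node a []) ` rooted_forests bs R"
    let ?F = "\<lambda>c. rooted_forests (c # a # bs) (R - {c})"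
    have A: "finite (rooted_forests bs R)"
       "real (card (rooted_forests bs R)) = forest_count (length bs) (card R)"
      using less.hyps[of R bs] less.prems Cons by auto
    have F: "finite (?F c)"
       "real (card (?F c)) = forest_count (Suc (Suc (length bs))) (card R - 1)" if "c \<in> R" for c
    proof -
      have "card R > 0" using that less.prems card_gt_0_iff by blast
      then show "finite (?F c)"
       "real (card (?F c)) = forest_count (Suc (Suc (length bs))) (card R - 1)"
        using less.hyps[of "R - {c}" "c # a # bs"] less.prems Cons that by auto
    qed
    note shape = rooted_forests_Cons_Cons_shape
    have inj: "inj_on adopt_first (?F c)" for c
    proof (rule inj_onI)
      fix ss ss' assume ss: "ss \<in> ?F c" "ss' \<in> ?F c" and eq: "adopt_first ss = adopt_first ss'"
      obtain t us vs t' us' vs' where "ss = t # Node a us # vs" "ss' = t' # Node a us' # vs'"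
        using shape[OF ss(1)] shape[OF ss(2)] by blast
      then show "ss = ss'" using eq by simp
    qed
    \<comment> \<open>The label \<open>c\<close> can be read off from the result, as the first child
      of the first root.\<close>
    have disj: "adopt_first ` ?F c \<inter> adopt_first ` ?F d = {}" if "c \<noteq> d" for c d
    proof -
      have "adopt_first ss \<noteq> adopt_first ss'" if ss: "ss \<in> ?F c" "ss' \<in> ?F d" for ss ss'
      proof -
        obtain t us vs t' us' vs' where "ss = t # Node a us # vs" "ss' = t' # Node a us' # vs'"
          "root t = c" "root t' = d"
          using shape[OF ss(1)] shape[OF ss(2)] by blast
        then show ?thesis using \<open>c \<noteq> d\<close> by auto
      qed
      then show ?thesis by blast
    qed
    have disjA: "?A \<inter> (\<Union>c\<in>R. adopt_first ` ?F c) = {}"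
    proof -
      have "Node a [] # ts \<noteq> adopt_first ss" if "ss \<in> ?F c" for ss c ts
        using shape[OF that] by auto
      then show ?thesis by auto
    qed
    have cardB: "real (card (\<Union>c\<in>R. adopt_first ` ?F c)) =
        real (card R) * forest_count (Suc (Suc (length bs))) (card R - 1)"
      using less.prems F disj inj by (subst card_UN_disjoint) (auto simp: card_image)
    have fin: "finite (rooted_forests as R)"
      unfolding Cons rooted_forests_Cons[OF less.prems] using A F less.prems by auto
    have "real (card (rooted_forests as R)) = real (card ?A) + real (card (\<Union>c\<in>R. adopt_first ` ?F c))"
      unfolding Cons rooted_forests_Cons[OF less.prems] using A F less.prems disjA
      by (subst card_Un_disjoint) auto
    also have "card ?A = card (rooted_forests bs R)" by (rule card_image) simp
    finally have "real (card (rooted_forests as R)) = forest_count (length bs) (card R)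
       + real (card R) * forest_count (Suc (Suc (length bs))) (card R - 1)"
      using A cardB by simp
    \<comment> \<open>For \<open>card R = 0\<close> the second summand vanishes, so the truncated
      \<open>card R - 1\<close> does no harm.\<close>
    also have "\<dots> = forest_count (Suc (length bs)) (card R)"
      by (cases "card R") (simp_all add: forest_count_Suc forest_count_0_right)
    finally show ?thesis using fin Cons by simp
  qed
qed

section \<open>Trees on an arbitrary finite label set\<close>

definition trees_on :: "'a set \<Rightarrow> 'a otree set" where
  "trees_on S = {T. mset (labels T) = mset_set S}"

lemma trees_on_iff:
  assumes "finite S"
  shows "T \<in> trees_on S \<longleftrightarrow> distinct (labels T) \<and> verts T = S"
  unfolding trees_on_def verts_def using assms
  by (metis (mono_tags, lifting) finite_set_mset_mset_set mem_Collect_eq mset_set_set 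
      set_mset_mset distinct_count_atmost_1 count_mset_set' mset_eq_setD)

text \<open>A tree is a forest with one prescribed root, so finiteness follows from the count of
  forests.\<close>

lemma finite_trees_on:
  assumes "finite S"
  shows "finite (trees_on S)"
proof -
  have "trees_on S \<subseteq> hd ` (\<Union>a\<in>S. rooted_forests [a] (S - {a}))"
  proof
    fix T assume T: "T \<in> trees_on S"
    then have r: "root T \<in> S"
      using assms by (auto simp: trees_on_iff verts_def)
    then have "[T] \<in> rooted_forests [root T] (S - {root T})"
      using T assms by (simp add: rooted_forests_def trees_on_def mset_set.remove)
    then show "T \<in> hd ` (\<Union>a\<in>S. rooted_forests [a] (S - {a}))"
      using r by (intro image_eqI[of _ _ "[T]"]) auto
  qed
  then show ?thesis
    by (rule finite_subset) (simp add: assms card_rooted_forests)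
qed

section \<open>Cutting a tree along its increasing edges\<close>

fun prune :: "nat otree \<Rightarrow> nat otree" where
  "prune (Node a ts) = Node a (map (\<lambda>t. if root t < a then prune t else Node (root t) []) ts)"

text \<open>The list follows the depth-first order of the increasing leaves of
  \<open>prune T\<close>, so position alone tells onto which leaf a subtree is to be glued
  back.\<close>

fun hanging :: "nat otree \<Rightarrow> nat otree list" where
  "hanging (Node a ts) = concat (map (\<lambda>t. if root t < a then hanging t else [t]) ts)"

lemma root_prune [simp]: "root (prune T) = root T"
  by (cases T) simp

lemma MD_prune [simp]: "MD (prune T) = MD T"
  by (induction T rule: prune.induct) (auto simp: filter_map o_def intro!: map_cong)

lemma prune_prune [simp]: "prune (prune T) = prune T"
  by (induction T rule: prune.induct) auto

text \<open>The pruned tree alone determines the roots of the cut-off forest; hence the trees with a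
  given pruned tree correspond to forests with prescribed roots.\<close>

lemma roots_hanging_prune: "map root (hanging (prune T)) = map root (hanging T)"
proof (induction T rule: prune.induct)
  case (1 a ts)
  then show ?case
    by (induction ts) auto
qed

lemma mset_labels_hanging:
  "mset (labels T) = mset (labels (MD T)) + mset (forest_labels (hanging T))"
proof (induction T rule: prune.induct)
  case (1 a ts)
  then show ?case
    by (induction ts) (auto simp: ac_simps)
qed

lemma mset_labels_prune:
  "mset (labels (prune T)) = mset (labels (MD T)) + mset (map root (hanging T))"
proof (induction T rule: prune.induct)
  case (1 a ts)
  then show ?case
    by (induction ts) (auto simp: ac_simps)
qed

text \<open>\<open>hanging\<close> concatenates one block per child, and the pruned children
  determine the block lengths. So equal lists split at the same places, and the induction applies
  child by child.\<close>

lemma prune_hanging_inj: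
  "prune T = prune T' \<Longrightarrow> hanging T = hanging T' \<Longrightarrow> T = T'"
proof (induction T arbitrary: T' rule: prune.induct)
  case (1 a ts)
  obtain b ts' where T': "T' = Node b ts'" by (cases T')
  let ?p = "\<lambda>t. if root t < a then prune t else Node (root t) []"
  let ?h = "\<lambda>t. if root t < a then hanging t else [t]"
  have ab: "b = a" and p: "map ?p ts = map ?p ts'" 
    and h: "concat (map ?h ts) = concat (map ?h ts')"
    using 1(2,3) T' by auto
  have IH: "\<And>t t'. t \<in> set ts \<Longrightarrow> root t < a \<Longrightarrow> prune t = prune t' \<Longrightarrow> hanging t = hanging t' \<Longrightarrow> t = t'"
    using 1(1) by blast
  have "ts = ts'" using p h IH
  proof (induction ts arbitrary: ts')
    case Nil
    then show ?case by simp
  next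
    case (Cons t ts)
    obtain s ss where ts': "ts' = s # ss" using Cons.prems(1) by (cases ts') auto
    have ps: "?p t = ?p s" "map ?p ts = map ?p ss" using Cons.prems(1) ts' by auto
    have roots: "root t = root s" using ps(1) by (metis otree.sel(1) root_prune)
    have "length (?h t) = length (?h s)"
      using ps(1) roots by (metis length_map roots_hanging_prune length_Cons)
    then have hs: "?h t = ?h s" "concat (map ?h ts) = concat (map ?h ss)"
      using Cons.prems(2) ts' by (auto simp del: if_split)
    have "t = s"
      using ps(1) hs(1) roots Cons.prems(3)[of t s] by (auto split: if_splits)
    moreover have "ts = ss"
      using Cons.IH[OF ps(2) hs(2)] Cons.prems(3) by auto
    ultimately show ?case using ts' by simp
  qed
  then show ?case using T' ab by simp
qed

text \<open>\<open>fs\<close> is cut into consecutive blocks, one per child, according to the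
  prescribed roots. A decreasing child is rebuilt from its block by induction; an increasing child
  is a bare leaf because \<open>P\<close> is pruned, and the single tree of its block replaces
  it.\<close>

lemma prune_hanging_surj:
  "prune P = P \<Longrightarrow> map root fs = map root (hanging P) \<Longrightarrow> \<exists>T. prune T = P \<and> hanging T = fs"
proof (induction P arbitrary: fs rule: prune.induct)
  case (1 a ts)
  let ?p = "\<lambda>t. if root t < a then prune t else Node (root t) []"
  let ?h = "\<lambda>t. if root t < a then hanging t else [t]"
  have p: "map ?p ts = ts" and h: "map root fs = map root (concat (map ?h ts))"
    using 1(2,3) by auto
  have IH: "\<And>t fs. t \<in> set ts \<Longrightarrow> root t < a \<Longrightarrow> prune t = t \<Longrightarrow>
      map root fs = map root (hanging t) \<Longrightarrow> \<exists>T. prune T = t \<and> hanging T = fs"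
    using 1(1) by blast
  have "\<exists>us. map ?p us = ts \<and> concat (map ?h us) = fs" using p h IH
  proof (induction ts arbitrary: fs)
    case Nil
    then show ?case by simp
  next
    case (Cons t ts)
    obtain f1 f2 where f: "fs = f1 @ f2" "map root f1 = map root (?h t)"
      "map root f2 = map root (concat (map ?h ts))"
      using Cons.prems(2) by (auto simp: map_eq_append_conv simp del: if_split)
    obtain us where us: "map ?p us = ts" "concat (map ?h us) = f2"
      using Cons.IH[of f2] Cons.prems(1,3) f(3) by auto
    have "\<exists>u. ?p u = t \<and> ?h u = f1"
    proof (cases "root t < a")
      case True
      then have "prune t = t" using Cons.prems(1) by auto
      then obtain u where "prune u = t" "hanging u = f1"
        using Cons.prems(3)[of t f1] f(2) True by auto
      then show ?thesis using True by (intro exI[of _ u]) auto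
    next
      case False
      then obtain u where "f1 = [u]" "root u = root t" using f(2) by auto
      moreover have "Node (root t) [] = t" using Cons.prems(1) False by auto
      ultimately show ?thesis using False by (intro exI[of _ u]) auto
    qed
    then obtain u where "?p u = t" "?h u = f1" by blast
    then show ?case using us f(1) by (intro exI[of _ "u # us"]) auto
  qed
  then obtain us where "map ?p us = ts" "concat (map ?h us) = fs" by blast
  then show ?case by (intro exI[of _ "Node a us"]) auto
qed

lemma Suc_length_edges: "Suc (length (edges T)) = length (labels T)"
proof (induction T rule: edges.induct)
  case (1 a ts)
  then have "length ts + length (concat (map edges ts)) = length (forest_labels ts)"
  proof (induction ts)
    case (Cons t ts)
    have "Suc (length (edges t)) = length (labels t)" using Cons.prems by simp
    moreover have "length ts + length (concat (map edges ts)) = length (forest_labels ts)"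
      using Cons by simp
    ultimately show ?case by simp
  qed simp
  then show ?case by simp
qed

lemma length_edges_iff: "length (edges T) = k \<longleftrightarrow> length (labels T) = Suc k"
  by (simp flip: Suc_length_edges)

lemma edge_prune_parent: "(v, w) \<in> set (edges (prune T)) \<Longrightarrow> v \<in> verts (MD T)"
proof (induction T rule: prune.induct)
  case (1 a ts)
  then show ?case by (fastforce simp: verts_def split: if_splits)
qed

lemma hanging_parent:
  "t \<in> set (hanging T) \<Longrightarrow> \<exists>u\<in>verts (MD T). (u, root t) \<in> set (edges T)"
proof (induction T rule: prune.induct)
  case (1 a ts)
  then obtain s where s: "s \<in> set ts" "t \<in> set (if root s < a then hanging s else [s])" by auto
  show ?case
  proof (cases "root s < a")
    case True
    then obtain u where "u \<in> verts (MD s)" "(u, root t) \<in> set (edges s)" using 1 s by auto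
    then show ?thesis using s True by (intro bexI[of _ u]) (auto simp: verts_def)
  next
    case False
    then show ?thesis using s by (intro bexI[of _ a]) (auto simp: verts_def)
  qed
qed

lemma hanging_edges: "t \<in> set (hanging T) \<Longrightarrow> set (edges t) \<subseteq> set (edges T)"
proof (induction T rule: prune.induct)
  case (1 a ts)
  then show ?case by (fastforce split: if_splits)
qed

lemma prune_id_if_hanging_leaves:
  "(\<And>t. t \<in> set (hanging T) \<Longrightarrow> children t = []) \<Longrightarrow> prune T = T"
proof (induction T rule: prune.induct)
  case (1 a ts)
  have "(if root t < a then prune t else Node (root t) []) = t" if "t \<in> set ts" for t
  proof (cases "root t < a")
    case True
    then show ?thesis using 1 that by auto
  next
    case False
    then have "children t = []" using 1(2)[of t] that by auto
    then show ?thesis using False by (metis otree.collapse)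
  qed
  then show ?case by (simp add: map_idI)
qed

text \<open>Turns the vertex condition of \<open>Z_set\<close> into a fixed-point equation. In a
  pruned tree the vertices outside \<open>MD T\<close> are the roots of hanging trees, and only
  vertices of \<open>MD T\<close> have children. Conversely, distinctness keeps the hanging roots
  outside \<open>MD T\<close>, so they are leaves and nothing is cut.\<close>

lemma prune_id_iff:
  assumes "distinct (labels T)"
  shows "prune T = T \<longleftrightarrow> (\<forall>v \<in> verts T - verts (MD T).
        is_leaf T v \<and> (\<exists>u \<in> verts (MD T). (u, v) \<in> set (edges T)))" (is "_ \<longleftrightarrow> ?R")
proof
  assume P: "prune T = T"
  show ?R
  proof
    fix v assume v: "v \<in> verts T - verts (MD T)"
    have "set (labels T) = set (labels (MD T)) \<union> root ` set (hanging T)"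
      using mset_labels_prune[of T] unfolding P
      by (metis mset_append set_append set_map set_mset_mset)
    then obtain t where t: "t \<in> set (hanging T)" "v = root t"
      using v by (auto simp: verts_def)
    have "is_leaf T v"
      using v edge_prune_parent[of v _ T] P by (auto simp: is_leaf_def)
    then show "is_leaf T v \<and> (\<exists>u \<in> verts (MD T). (u, v) \<in> set (edges T))"
      using hanging_parent[OF t(1)] t(2) by simp
  qed
next
  assume R: ?R
  show "prune T = T"
  proof (rule prune_id_if_hanging_leaves)
    fix t assume t: "t \<in> set (hanging T)"
    have "mset (labels T) = mset (labels (MD T) @ forest_labels (hanging T))"
      using mset_labels_hanging[of T] by simp
    then have "distinct (labels (MD T) @ forest_labels (hanging T))"
      and S: "set (labels T) = set (labels (MD T) @ forest_labels (hanging T))"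
      using assms mset_eq_imp_distinct_iff mset_eq_setD by blast+
    moreover have "root t \<in> set (forest_labels (hanging T))"
      using t root_in_labels[of t] by (force simp del: root_in_labels)
    ultimately have "root t \<in> verts T - verts (MD T)"
      by (auto simp: verts_def)
    then have leaf: "is_leaf T (root t)" using R by blast
    show "children t = []"
    proof (rule ccontr)
      assume "children t \<noteq> []"
      then obtain w where "(root t, w) \<in> set (edges t)"
        by (cases t; cases "children t") auto
      then show False using hanging_edges[OF t] leaf by (auto simp: is_leaf_def)
    qed
  qed
qed

section \<open>Pruned trees and order-preserving relabeling\<close>

definition pruned_trees :: "nat set \<Rightarrow> nat \<Rightarrow> nat otree set" where
  "pruned_trees S k = {P \<in> trees_on S. length (labels (MD P)) = Suc k \<and> prune P = P}"

lemma ordered_labeled_trees_eq: "ordered_labeled_trees n = trees_on {0..n}"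
  by (auto simp: ordered_labeled_trees_def trees_on_iff)

lemma Z_set_eq: "Z_set m k = pruned_trees {0..m} k"
  unfolding Z_set_def pruned_trees_def ordered_labeled_trees_eq length_edges_iff
  using prune_id_iff by (auto simp: trees_on_iff)

lemma O_set_eq: "O_set n k = {T \<in> trees_on {0..n}. length (labels (MD T)) = Suc k}"
  unfolding O_set_def ordered_labeled_trees_eq length_edges_iff ..

lemma labels_map_otree: "labels (map_otree f T) = map f (labels T)"
  by (induction T rule: labels.induct) (auto simp: map_concat o_def intro!: arg_cong[of _ _ concat])

lemma root_map_otree [simp]: "root (map_otree f T) = f (root T)"
  by (cases T) simp

lemma set_otree_eq: "set_otree T = set (labels T)"
  by (induction T rule: labels.induct) auto

lemma MD_map_otree:
  assumes "strict_mono f"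
  shows "MD (map_otree f T) = map_otree f (MD T)"
  by (induction T rule: MD.induct)
    (auto simp: filter_map o_def strict_mono_less[OF assms] intro!: map_cong)

lemma prune_map_otree:
  assumes "strict_mono f"
  shows "prune (map_otree f T) = map_otree f (prune T)"
  by (induction T rule: prune.induct) (auto simp: strict_mono_less[OF assms])

text \<open>A map that is strictly monotone on all naturals is obtained by adding to
  \<open>S\<close> an infinite tail above \<open>Max S\<close> and enumerating the union. The
  indices mapped into \<open>S\<close> are downward closed and \<open>m + 1\<close> in number, hence
  they are \<open>{0..m}\<close>.\<close>

lemma ex_strict_mono_image:
  fixes S :: "nat set"
  assumes "finite S" "card S = Suc m"
  shows "\<exists>f. strict_mono f \<and> f ` {0..m} = S"
proof -
  have "S \<noteq> {}" using assms by auto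
  define U where "U = S \<union> {Suc (Max S)..}"
  have inf: "infinite U" by (simp add: U_def infinite_Ici)
  have sm: "strict_mono (enumerate U)"
    using inf by (simp add: strict_mono_enumerate)
  have bij: "range (enumerate U) = U" using inf by (rule range_enumerate)
  define A where "A = {i. enumerate U i \<in> S}"
  have imA: "enumerate U ` A = S" using bij by (auto simp: A_def U_def)
  have down: "j \<in> A" if "i \<in> A" "j \<le> i" for i j
  proof -
    have "enumerate U j \<le> Max S"
      using that assms(1) sm by (metis A_def Max_ge le_trans mem_Collect_eq strict_mono_less_eq)
    then show ?thesis using bij by (force simp: A_def U_def)
  qed
  have inj: "inj (enumerate U)" using sm by (rule strict_mono_imp_inj_on)
  have cA: "card A = Suc m" "finite A"
    using imA assms inj by (metis card_image inj_on_subset subset_UNIV, metis finite_imageD inj_on_subset subset_UNIV)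
  have "A \<subseteq> {0..m}"
  proof
    fix i assume "i \<in> A"
    then have "{0..i} \<subseteq> A" using down by auto
    then have "card {0..i} \<le> card A" using cA card_mono by blast
    then show "i \<in> {0..m}" using cA by simp
  qed
  then have "A = {0..m}" using cA by (simp add: card_subset_eq)
  then show ?thesis using imA sm by blast
qed

lemma map_otree_in_pruned_trees_iff:
  assumes "strict_mono f" "finite S"
  shows "map_otree f P \<in> pruned_trees (f ` S) k \<longleftrightarrow> P \<in> pruned_trees S k"
proof -
  have inj: "inj f" using assms(1) by (rule strict_mono_imp_inj_on)
  have "map_otree f P \<in> trees_on (f ` S) \<longleftrightarrow> P \<in> trees_on S"
    using inj assms(2)
    by (auto simp: trees_on_iff verts_def labels_map_otree distinct_map inj_image_eq_iff inj_image_mem_iff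
      intro: inj_on_subset)
  then show ?thesis
    using inj_eq[OF otree.inj_map[OF inj]] assms(1)
    by (simp add: pruned_trees_def MD_map_otree prune_map_otree labels_map_otree)
qed

text \<open>\<open>MD\<close> and \<open>prune\<close> depend only on the relative order of the
  labels, so relabeling along a strictly monotone map is a bijection from the trees on
  \<open>{0..m}\<close>.\<close>

lemma card_pruned_trees:
  assumes "finite S" "card S = Suc m"
  shows "card (pruned_trees S k) = z_num m k"
proof -
  obtain f where f: "strict_mono f" "f ` {0..m} = S"
    using ex_strict_mono_image[OF assms] by blast
  have inj: "inj f" using f(1) by (rule strict_mono_imp_inj_on)
  have "pruned_trees S k = map_otree f ` pruned_trees {0..m} k"
  proof (intro equalityI subsetI)
    fix P assume P: "P \<in> pruned_trees S k"
    \<comment> \<open>\<open>inv f\<close> need not be monotone outside the range of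
      \<open>f\<close>, so membership of \<open>?Q\<close> is transferred back through
      \<open>map_otree f ?Q = P\<close>.\<close>
    let ?Q = "map_otree (inv f) P"
    have "set_otree P = f ` {0..m}"
      using P assms(1) f by (auto simp: pruned_trees_def trees_on_iff verts_def set_otree_eq)
    then have Q: "map_otree f ?Q = P"
      unfolding otree.map_comp using inj by (intro otree.map_ident_strong) auto
    then have "?Q \<in> pruned_trees {0..m} k"
      using map_otree_in_pruned_trees_iff[OF f(1), of "{0..m}" ?Q k] P f(2) by simp
    then show "P \<in> map_otree f ` pruned_trees {0..m} k" using Q by (metis image_eqI)
  next
    fix P assume "P \<in> map_otree f ` pruned_trees {0..m} k"
    then show "P \<in> pruned_trees S k"
      using map_otree_in_pruned_trees_iff[OF f(1), of "{0..m}"] f(2) by auto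
  qed
  then show ?thesis
    using otree.inj_map[OF inj] by (simp add: z_num_def Z_set_eq card_image inj_on_subset)
qed

lemma finite_pruned_trees: "finite S \<Longrightarrow> finite (pruned_trees S k)"
  by (rule finite_subset[OF _ finite_trees_on]) (auto simp: pruned_trees_def)

text \<open>The number of prescribed roots depends only on \<open>card S\<close> and
  \<open>k\<close>: a pruned tree consists of the \<open>k + 1\<close> vertices of its maximal
  decreasing subtree and one leaf per hanging tree.\<close>

lemma length_hanging_pruned:
  assumes "P \<in> pruned_trees S k" "finite S"
  shows "card S = Suc k + length (hanging P)"
proof -
  have "length (labels P) = card S"
    using assms by (auto simp: pruned_trees_def trees_on_iff verts_def distinct_card)
  moreover have "length (labels P) = Suc k + length (hanging P)"
    using arg_cong[OF mset_labels_prune[of P], of size] assms(1)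
    by (simp add: pruned_trees_def)
  ultimately show ?thesis by simp
qed

section \<open>The cutting bijection and the resulting sum\<close>

text \<open>Injectivity and preimages come from \<open>prune_hanging_inj\<close> and
  \<open>prune_hanging_surj\<close>. The rest is bookkeeping: the non-root labels of the hanging
  trees fill exactly the complement of the labels of the pruned tree.\<close>

lemma O_set_bij:
  "bij_betw (\<lambda>T. (prune T, hanging T)) (O_set n k)
     (SIGMA P : (\<Union>S\<in>Pow {0..n}. pruned_trees S k).
        rooted_forests (map root (hanging P)) ({0..n} - verts P))"
  (is "bij_betw ?f _ ?B")
proof (rule bij_betw_imageI)
  show "inj_on ?f (O_set n k)" by (rule inj_onI) (auto intro: prune_hanging_inj)
  show "?f ` O_set n k = ?B"
  proof (intro equalityI subsetI)
    fix x assume "x \<in> ?f ` O_set n k"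
    then obtain T where T: "mset (labels T) = mset_set {0..n}"
      "length (labels (MD T)) = Suc k" "x = (prune T, hanging T)"
      by (auto simp: O_set_eq trees_on_def)
    define S where "S = verts (prune T)"
    have sub: "mset (labels (prune T)) \<subseteq># mset_set {0..n}"
      unfolding mset_labels_prune T(1)[symmetric] mset_labels_hanging[of T]
      using mset_roots_subseteq by (rule subset_mset.add_left_mono)
    have S: "S \<subseteq> {0..n}" using mset_subset_eqD[OF sub] by (auto simp: S_def verts_def)
    have "count (mset (labels (prune T))) a \<le> 1" for a
      using mset_subset_eq_count[OF sub, of a] by (metis count_mset_set' le_trans order_refl zero_le_one)
    then have "distinct (labels (prune T))"
      unfolding distinct_count_atmost_1
      by (metis One_nat_def count_mset_0_iff count_greater_eq_one_iff le_antisym set_mset_mset)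
    then have "prune T \<in> pruned_trees S k"
      using T(2) by (simp add: pruned_trees_def S_def trees_on_iff verts_def)
    moreover have "hanging T \<in> rooted_forests (map root (hanging (prune T))) ({0..n} - S)"
    proof -
      have "mset_set ({0..n} - S) = mset_set {0..n} - mset_set S"
        using S by (simp add: mset_set_Diff)
      also have "mset_set S = mset (labels (prune T))"
        using \<open>prune T \<in> _\<close> by (simp add: pruned_trees_def trees_on_def)
      also have "mset_set {0..n} = mset (labels (MD T)) + mset (forest_labels (hanging T))"
        using T(1) mset_labels_hanging[of T] by simp
      finally have "mset_set ({0..n} - S) =
          mset (forest_labels (hanging T)) - mset (map root (hanging T))"
        by (simp add: mset_labels_prune)
      \<comment> \<open>Multiset difference is truncated; as the roots are contained in the forest
        labels, it can be turned back into the sum required by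
        \<open>rooted_forests\<close>.\<close>
      then show ?thesis using mset_roots_subseteq[of "hanging T"]
        by (simp add: rooted_forests_def roots_hanging_prune del: mset_map)
    qed
    ultimately show "x \<in> ?B" using S T(3) by (auto simp: S_def)
  next
    fix x assume "x \<in> ?B"
    then obtain P fs S where x: "x = (P, fs)" "S \<subseteq> {0..n}" "P \<in> pruned_trees S k"
      and fs: "fs \<in> rooted_forests (map root (hanging P)) ({0..n} - verts P)" by auto
    have fin: "finite S" using x(2) finite_subset by blast
    have P: "prune P = P" "mset (labels P) = mset_set S" "length (labels (MD P)) = Suc k"
      using x(3) by (auto simp: pruned_trees_def trees_on_def)
    have "verts P = S" using x(3) fin by (simp add: pruned_trees_def trees_on_iff)
    note P = P this
    obtain T where T: "prune T = P" "hanging T = fs"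
      using prune_hanging_surj[OF P(1), of fs] fs by (auto simp: rooted_forests_def)
    have MD: "MD T = MD P" using T(1) MD_prune by metis
    have "mset (labels T) = mset (labels (MD P)) + mset (forest_labels fs)"
      using mset_labels_hanging[of T] T MD by simp
    also have "mset (forest_labels fs) = mset (map root (hanging P)) + mset_set ({0..n} - S)"
      using fs P(4) by (simp add: rooted_forests_def)
    also have "mset (labels (MD P)) + \<dots> = mset_set S + mset_set ({0..n} - S)"
      using mset_labels_prune[of P] P by (simp add: add.assoc)
    also have "\<dots> = mset_set {0..n}"
      using x(2) fin by (metis Diff_disjoint Diff_partition finite_Diff finite_atLeastAtMost mset_set_Union)
    finally have "T \<in> O_set n k"
      using MD P(3) by (simp add: O_set_eq trees_on_def)
    then show "x \<in> ?f ` O_set n k" using x(1) T by force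
  qed
qed

lemma sum_Pow_card:
  fixes h :: "nat \<Rightarrow> real"
  assumes "finite A"
  shows "(\<Sum>S\<in>Pow A. h (card S)) = (\<Sum>j\<le>card A. real (card A choose j) * h j)"
proof -
  have "(\<Sum>S\<in>Pow A. h (card S)) = (\<Sum>j\<le>card A. \<Sum>S\<in>{S\<in>Pow A. card S = j}. h (card S))"
    using assms by (intro sum.group[symmetric]) (auto intro: card_mono)
  also have "\<dots> = (\<Sum>j\<le>card A. real (card A choose j) * h j)"
    using assms by (intro sum.cong) (auto simp: n_subsets)
  finally show ?thesis .
qed

text \<open>The contribution of a label set \<open>S\<close> for the pruned part depends only on its
  size \<open>m + 1\<close>. Choosing \<open>S\<close> among \<open>n + 1\<close> labels gives the
  binomial coefficient, and the forest has \<open>m - k\<close> roots and \<open>n - m\<close>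
  further vertices.\<close>

lemma o_num_eq_sum:
  "real (o_num n k) = (\<Sum>m=k..n. real ((n + 1) choose (m + 1)) * (real (z_num m k)
     * forest_count (m - k) (n - m)))"
proof -
  define U where "U = Pow {0..n}"
  define F where "F P = rooted_forests (map root (hanging P)) ({0..n} - verts P)" for P
  \<comment> \<open>Here \<open>j\<close> stands for \<open>card S = m + 1\<close>; sizes below
    \<open>k + 1\<close> cannot hold the maximal decreasing subtree and contribute 0.\<close>
  define h where "h j = (if j \<ge> Suc k then real (z_num (j - 1) k)
      * forest_count (j - Suc k) (Suc n - j) else 0)" for j
  have finU: "finite S" if "S \<in> U" for S using that finite_subset by (auto simp: U_def)
  have finF: "finite (F P)" for P by (simp add: F_def card_rooted_forests)
  have "o_num n k = card (SIGMA P : (\<Union>S\<in>U. pruned_trees S k). F P)"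
    unfolding o_num_def U_def F_def by (rule bij_betw_same_card[OF O_set_bij])
  also have "\<dots> = (\<Sum>P\<in>(\<Union>S\<in>U. pruned_trees S k). card (F P))"
    using finU finF by (intro card_SigmaI) (auto simp: finite_pruned_trees U_def)
  also have "\<dots> = (\<Sum>S\<in>U. \<Sum>P\<in>pruned_trees S k. card (F P))"
  proof (rule sum.UNION_disjoint)
    show "\<forall>S\<in>U. \<forall>S'\<in>U. S \<noteq> S' \<longrightarrow> pruned_trees S k \<inter> pruned_trees S' k = {}"
      using finU by (auto simp: pruned_trees_def trees_on_iff)
  qed (use finU in \<open>auto simp: finite_pruned_trees U_def\<close>)
  finally have "real (o_num n k) = (\<Sum>S\<in>U. \<Sum>P\<in>pruned_trees S k. real (card (F P)))" by simp
  also have "\<dots> = (\<Sum>S\<in>U. h (card S))"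
  proof (rule sum.cong[OF refl])
    fix S assume S: "S \<in> U"
    have "(\<Sum>P\<in>pruned_trees S k. real (card (F P))) =
        (\<Sum>P\<in>pruned_trees S k. forest_count (card S - Suc k) (Suc n - card S))"
    proof (rule sum.cong[OF refl])
      fix P assume P: "P \<in> pruned_trees S k"
      then have "verts P = S" using finU[OF S] by (simp add: pruned_trees_def trees_on_iff)
      then have "card ({0..n} - verts P) = Suc n - card S"
        using S finU[OF S] by (simp add: U_def card_Diff_subset)
      then show "real (card (F P)) = forest_count (card S - Suc k) (Suc n - card S)"
        using length_hanging_pruned[OF P finU[OF S]]
        by (simp add: F_def card_rooted_forests)
    qed
    also have "\<dots> = h (card S)"
    proof (cases "Suc k \<le> card S")
      case True
      then show ?thesis using card_pruned_trees[OF finU[OF S], of "card S - 1" k]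
        by (simp add: h_def)
    next
      case False
      then have "pruned_trees S k = {}"
        using length_hanging_pruned[OF _ finU[OF S]] by fastforce
      then show ?thesis using False by (simp add: h_def)
    qed
    finally show "(\<Sum>P\<in>pruned_trees S k. real (card (F P))) = h (card S)" .
  qed
  also have "\<dots> = (\<Sum>j\<le>Suc n. real (Suc n choose j) * h j)"
    unfolding U_def by (subst sum_Pow_card) auto
  also have "\<dots> = (\<Sum>j\<in>{Suc k..Suc n}. real (Suc n choose j) * h j)"
    by (rule sum.mono_neutral_right) (auto simp: h_def)
  also have "\<dots> = (\<Sum>m=k..n. real (Suc n choose Suc m) * h (Suc m))"
    by (rule sum.shift_bounds_cl_Suc_ivl)
  also have "\<dots> = (\<Sum>m=k..n. real ((n + 1) choose (m + 1)) * (real (z_num m k)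
     * forest_count (m - k) (n - m)))"
    by (intro sum.cong) (auto simp: h_def)
  finally show ?thesis .
qed

section \<open>Decreasing trees\<close>

text \<open>The bound \<open>b\<close> stands for the label of a parent above the whole forest.
  Working with forests makes the children of a vertex and its later siblings objects of the same
  kind.\<close>

fun decreasing_below :: "nat \<Rightarrow> nat otree list \<Rightarrow> bool" where
  "decreasing_below b [] \<longleftrightarrow> True"
| "decreasing_below b (Node a us # ts) \<longleftrightarrow>
     a < b \<and> decreasing_below a us \<and> decreasing_below b ts"

text \<open>The places are one directly before each vertex and one at the end of each sibling list,
  the top-level list included.\<close>

fun leaf_insertions :: "'a \<Rightarrow> 'a otree list \<Rightarrow> 'a otree list set" where
  "leaf_insertions x [] = {[Node x []]}"
| "leaf_insertions x (Node a us # ts) =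
     insert (Node x [] # Node a us # ts)
       ((\<lambda>us'. Node a us' # ts) ` leaf_insertions x us \<union>
        (\<lambda>ts'. Node a us # ts') ` leaf_insertions x ts)"

text \<open>In the counting argument \<open>x\<close> labels a leaf, so dropping the children of
  \<open>x\<close> loses nothing.\<close>

fun delete_leaf :: "'a \<Rightarrow> 'a otree list \<Rightarrow> 'a otree list" where
  "delete_leaf x [] = []"
| "delete_leaf x (Node a us # ts) =
     (if a = x then ts else Node a (delete_leaf x us) # delete_leaf x ts)"

lemma mset_leaf_insertions:
  "ts' \<in> leaf_insertions x ts \<Longrightarrow>
     mset (forest_labels ts') = add_mset x (mset (forest_labels ts))"
  by (induction x ts arbitrary: ts' rule: leaf_insertions.induct) auto

lemma delete_leaf_notin: "x \<notin> set (forest_labels ts) \<Longrightarrow> delete_leaf x ts = ts"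
  by (induction x ts rule: delete_leaf.induct) auto

lemma delete_leaf_insertion:
  "x \<notin> set (forest_labels ts) \<Longrightarrow> ts' \<in> leaf_insertions x ts \<Longrightarrow> delete_leaf x ts' = ts"
  by (induction x ts arbitrary: ts' rule: leaf_insertions.induct) (auto simp: delete_leaf_notin)

text \<open>Insertion at the front is recognized by the fresh first label. Insertions among the
  children and among the later siblings differ, since an insertion always changes the forest it is
  made in. The three kinds of places add up to \<open>1 + (2 * u + 1) + (2 * t + 1)\<close>, where
  \<open>u\<close> and \<open>t\<close> are the sizes of the two parts.\<close>

lemma card_leaf_insertions:
  "x \<notin> set (forest_labels ts) \<Longrightarrow>
     finite (leaf_insertions x ts) \<and>
     card (leaf_insertions x ts) = 2 * length (forest_labels ts) + 1"
proof (induction x ts rule: leaf_insertions.induct)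
  case (2 x a us ts)
  let ?A = "(\<lambda>us'. Node a us' # ts) ` leaf_insertions x us"
  let ?B = "(\<lambda>ts'. Node a us # ts') ` leaf_insertions x ts"
  have x: "x \<noteq> a" "x \<notin> set (forest_labels us)" "x \<notin> set (forest_labels ts)" using 2(3) by auto
  have fin: "finite ?A" "finite ?B" using 2 x by auto
  have "us \<notin> leaf_insertions x us"
    using mset_leaf_insertions[of us x us] by auto
  then have disj: "?A \<inter> ?B = {}" by auto
  have new: "Node x [] # Node a us # ts \<notin> ?A \<union> ?B" using x by auto
  have "card ?A = 2 * length (forest_labels us) + 1"
    using 2(1) x by (subst card_image) (auto simp: inj_on_def)
  moreover have "card ?B = 2 * length (forest_labels ts) + 1"
    using 2(2) x by (subst card_image) (auto simp: inj_on_def)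
  ultimately show ?case
    using fin disj new by (simp add: card_Un_disjoint)
qed simp

lemma decreasing_below_labels:
  "decreasing_below b ts \<Longrightarrow> \<forall>y\<in>set (forest_labels ts). y < b"
  by (induction b ts rule: decreasing_below.induct) (auto intro: less_trans)

text \<open>A label below all others fits under any parent, and as a leaf it gets no child of its
  own.\<close>

lemma decreasing_below_leaf_insertions:
  "decreasing_below b ts \<Longrightarrow> x < b \<Longrightarrow> \<forall>y\<in>set (forest_labels ts). x < y \<Longrightarrow>
     ts' \<in> leaf_insertions x ts \<Longrightarrow> decreasing_below b ts'"
  by (induction b ts arbitrary: ts' rule: decreasing_below.induct) auto

lemma decreasing_below_delete_leaf:
  "decreasing_below b ts \<Longrightarrow> decreasing_below b (delete_leaf x ts)"
  by (induction b ts rule: decreasing_below.induct) auto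

text \<open>In a decreasing forest the minimal label sits at a leaf.\<close>

lemma leaf_insertion_delete_leaf:
  "decreasing_below b ts \<Longrightarrow> distinct (forest_labels ts) \<Longrightarrow>
     \<forall>y\<in>set (forest_labels ts). x \<le> y \<Longrightarrow> x \<in> set (forest_labels ts) \<Longrightarrow>
     ts \<in> leaf_insertions x (delete_leaf x ts)"
proof (induction b ts rule: decreasing_below.induct)
  case (2 b a us ts)
  show ?case
  proof (cases "a = x")
    case True
    have "us = []"
    proof (rule ccontr)
      assume "us \<noteq> []"
      then obtain y where y: "y \<in> set (forest_labels us)"
        by (cases us) (auto intro: root_in_labels)
      then have "y < a" using 2(3) decreasing_below_labels by auto
      moreover have "x \<le> y" using 2(5) y by simp
      ultimately show False using True by simp
    qed
    \<comment> \<open>Deletion returns \<open>ts\<close>; putting \<open>Node x []\<close> in front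
      is an insertion whether \<open>ts\<close> is empty or not.\<close>
    then show ?thesis using True by (cases "(b, ts)" rule: decreasing_below.cases) auto
  next
    case False
    \<comment> \<open>Distinctness confines \<open>x\<close> to one of the two parts, and
      \<open>delete_leaf\<close> leaves the other unchanged.\<close>
    then consider "x \<in> set (forest_labels us)" "x \<notin> set (forest_labels ts)"
      | "x \<notin> set (forest_labels us)" "x \<in> set (forest_labels ts)"
      using 2(4,6) by auto
    then show ?thesis
    proof cases
      case 1
      then show ?thesis using "2.IH"(1) "2.prems" False by (simp add: delete_leaf_notin)
    next
      case 2
      then show ?thesis using "2.IH"(2) "2.prems" False by (simp add: delete_leaf_notin)
    qed
  qed
qed simp

definition decreasing_forests :: "nat \<Rightarrow> nat set \<Rightarrow> nat otree list set" where
  "decreasing_forests b S = {ts. decreasing_below b ts \<and> mset (forest_labels ts) = mset_set S}"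

text \<open>Deleting the minimal label inverts its insertion; \<open>x < b\<close> is what permits
  \<open>x\<close> at top level.\<close>

lemma decreasing_forests_insert:
  assumes "finite S" "\<forall>y\<in>S. x < y" "x < b"
  shows "decreasing_forests b (insert x S) = (\<Union>ts\<in>decreasing_forests b S. leaf_insertions x ts)"
proof (intro equalityI subsetI)
  have x: "x \<notin> S" using assms(2) by auto
  fix ts assume ts: "ts \<in> decreasing_forests b (insert x S)"
  then have m: "mset (forest_labels ts) = mset_set (insert x S)" and d: "decreasing_below b ts"
    by (auto simp: decreasing_forests_def)
  have s: "set (forest_labels ts) = insert x S"
    using m assms(1) by (metis finite_insert finite_set_mset_mset_set set_mset_mset)
  have dist: "distinct (forest_labels ts)"
    using m s assms(1) unfolding distinct_count_atmost_1 by (simp add: count_mset_set')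
  have ins: "ts \<in> leaf_insertions x (delete_leaf x ts)"
  proof (rule leaf_insertion_delete_leaf[OF d dist])
    show "\<forall>y\<in>set (forest_labels ts). x \<le> y"
      unfolding s using assms(2) by (auto intro: less_imp_le)
    show "x \<in> set (forest_labels ts)" unfolding s by simp
  qed
  have "add_mset x (mset (forest_labels (delete_leaf x ts))) = add_mset x (mset_set S)"
    using mset_leaf_insertions[OF ins] m x assms(1) by simp
  then have "delete_leaf x ts \<in> decreasing_forests b S"
    using decreasing_below_delete_leaf[OF d] by (simp add: decreasing_forests_def)
  then show "ts \<in> (\<Union>ts\<in>decreasing_forests b S. leaf_insertions x ts)" using ins by blast
next
  have x: "x \<notin> S" using assms(2) by auto
  fix ts' assume "ts' \<in> (\<Union>ts\<in>decreasing_forests b S. leaf_insertions x ts)"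
  then obtain ts where ts: "decreasing_below b ts" "mset (forest_labels ts) = mset_set S"
      "ts' \<in> leaf_insertions x ts"
    by (auto simp: decreasing_forests_def)
  have s: "set (forest_labels ts) = S"
    using ts(2) assms(1) by (metis finite_set_mset_mset_set set_mset_mset)
  have "decreasing_below b ts'"
    by (rule decreasing_below_leaf_insertions[OF ts(1) assms(3) _ ts(3)]) (use s assms(2) in blast)
  then show "ts' \<in> decreasing_forests b (insert x S)"
    using mset_leaf_insertions[OF ts(3)] ts(2) x assms(1) by (simp add: decreasing_forests_def)
qed

text \<open>Labels are added in decreasing order. \<open>delete_leaf\<close> recovers the smaller
  forest, so the sets of insertions are disjoint, and each step multiplies the count by
  \<open>2 * card S + 1\<close>, the next odd number.\<close>

lemma card_decreasing_forests:
  assumes "finite S" "S \<subseteq> {..<b}"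
  shows "finite (decreasing_forests b S) \<and> card (decreasing_forests b S) = odd_double_fact (card S)"
  using assms
proof (induction S rule: finite_linorder_min_induct)
  case empty
  have "decreasing_forests b {} = {[]}"
    by (auto simp: decreasing_forests_def)
  then show ?case by (simp add: odd_double_fact_def)
next
  case (insert x S)
  have x: "x \<notin> S" using insert.hyps by auto
  have D: "x \<notin> set (forest_labels ts)" "length (forest_labels ts) = card S"
    if "ts \<in> decreasing_forests b S" for ts
  proof -
    have m: "mset (forest_labels ts) = mset_set S" using that by (simp add: decreasing_forests_def)
    then show "x \<notin> set (forest_labels ts)" using x insert.hyps(1)
      by (metis finite_set_mset_mset_set set_mset_mset)
    show "length (forest_labels ts) = card S" using m by (metis size_mset size_mset_set)
  qed
  have IH: "finite (decreasing_forests b S)"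
    "card (decreasing_forests b S) = odd_double_fact (card S)" using insert by auto
  have fin: "finite (leaf_insertions x ts)" 
    "card (leaf_insertions x ts) = 2 * card S + 1" if "ts \<in> decreasing_forests b S" for ts
    using card_leaf_insertions[OF D(1)[OF that]] D(2)[OF that] by auto
  have eq: "decreasing_forests b (insert x S) =
      (\<Union>ts\<in>decreasing_forests b S. leaf_insertions x ts)"
    using insert by (intro decreasing_forests_insert) auto
  have "card (decreasing_forests b (insert x S)) =
      (\<Sum>ts\<in>decreasing_forests b S. card (leaf_insertions x ts))"
    unfolding eq
  proof (rule card_UN_disjoint)
    show "\<forall>ts\<in>decreasing_forests b S. \<forall>us\<in>decreasing_forests b S. ts \<noteq> us \<longrightarrow>
        leaf_insertions x ts \<inter> leaf_insertions x us = {}"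
      by (metis delete_leaf_insertion D(1) disjoint_iff)
  qed (use IH fin in auto)
  also have "\<dots> = odd_double_fact (card S) * (2 * card S + 1)"
    using fin IH by simp
  also have "\<dots> = odd_double_fact (card (insert x S))"
    using x insert.hyps(1) by (simp add: odd_double_fact_def)
  finally show ?case using eq IH fin by auto
qed

section \<open>The case \<open>k = n\<close>: trees that are decreasing throughout\<close>

lemma decreasing_below_iff:
  "decreasing_below b ts \<longleftrightarrow> (\<forall>t\<in>set ts. root t < b \<and> decreasing_below (root t) (children t))"
  by (induction b ts rule: decreasing_below.induct) auto

text \<open>Both sides say that nothing is cut off, that is \<open>hanging T = []\<close>.\<close>

lemma length_labels_MD_eq_iff:
  "length (labels (MD T)) = length (labels T) \<longleftrightarrow> decreasing_below (root T) (children T)"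
proof -
  have "length (labels (MD T)) = length (labels T) \<longleftrightarrow> hanging T = []"
  proof -
    have "length (labels T) = length (labels (MD T)) + length (forest_labels (hanging T))"
      using arg_cong[OF mset_labels_hanging[of T], of size]
      by (simp only: size_union size_mset)
    then show ?thesis by (cases "hanging T") auto
  qed
  also have "\<dots> \<longleftrightarrow> decreasing_below (root T) (children T)"
  proof (induction T rule: hanging.induct)
    case (1 a ts)
    have "hanging (Node a ts) = [] \<longleftrightarrow> (\<forall>t\<in>set ts. root t < a \<and> hanging t = [])"
      by (induction ts) auto
    then show ?case using 1 unfolding otree.sel decreasing_below_iff[of a ts] by blast
  qed
  finally show ?thesis .
qed

text \<open>With \<open>n\<close> edges the maximal decreasing subtree is all of \<open>T\<close>.
  The root then carries the largest label \<open>n\<close>, and its children form a decreasing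
  forest on the other labels.\<close>

lemma O_set_diag: "O_set n n = Node n ` decreasing_forests n {0..<n}"
proof (intro equalityI subsetI)
  fix T assume "T \<in> O_set n n"
  then have m: "mset (labels T) = mset_set {0..n}" and l: "length (labels (MD T)) = Suc n"
    by (auto simp: O_set_eq trees_on_def)
  have "length (labels T) = Suc n" using arg_cong[OF m, of size] by simp
  then have d: "decreasing_below (root T) (children T)"
    using l length_labels_MD_eq_iff[of T] by simp
  obtain a ts where T: "T = Node a ts" by (cases T)
  have s: "set (labels T) = {0..n}"
    using m by (metis finite_atLeastAtMost finite_set_mset_mset_set set_mset_mset)
  have "n \<in> set (labels T)" "a \<le> n" using s T by auto
  then have "a = n" using d T decreasing_below_labels[of a ts] by force
  moreover have "{0..n} = insert n {0..<n}" by auto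
  ultimately have "ts \<in> decreasing_forests n {0..<n}"
    using m d T by (simp add: decreasing_forests_def)
  then show "T \<in> Node n ` decreasing_forests n {0..<n}" using T \<open>a = n\<close> by blast
next
  fix T assume "T \<in> Node n ` decreasing_forests n {0..<n}"
  then obtain ts where T: "T = Node n ts" "decreasing_below n ts"
    "mset (forest_labels ts) = mset_set {0..<n}" by (auto simp: decreasing_forests_def)
  have "{0..n} = insert n {0..<n}" by auto
  then have m: "mset (labels T) = mset_set {0..n}" using T by simp
  have "length (labels T) = Suc n" using arg_cong[OF m, of size] by simp
  then show "T \<in> O_set n n"
    using length_labels_MD_eq_iff[of T] T m by (simp add: O_set_eq trees_on_def)
qed

theorem theorem3:
  shows "(\<forall>n k :: nat. k < n \<longrightarrow>
      real (o_num n k) =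
        (\<Sum>m=k..n. real ((n + 1) choose (m + 1)) * real (z_num m k)
           * ((real m - real k) / (real n - real k))
           * pochhammer (real n - real k) (n - m)))
    \<and> (\<forall>n :: nat. o_num n n = odd_double_fact n)"
proof (intro conjI allI impI)
  fix n k :: nat assume "k < n"
  then show "real (o_num n k) =
        (\<Sum>m=k..n. real ((n + 1) choose (m + 1)) * real (z_num m k)
           * ((real m - real k) / (real n - real k))
           * pochhammer (real n - real k) (n - m))"
    unfolding o_num_eq_sum
    \<comment> \<open>Here \<open>(m - k) + (n - m) = n - k\<close> is positive, so
      \<open>forest_count\<close> is given by its fraction, and \<open>k \<le> m \<le> n\<close>
      makes the truncated differences exact.\<close>
    by (intro sum.cong) (auto simp: forest_count_def of_nat_diff)
next
  fix n :: nat
  have "card (O_set n n) = card (decreasing_forests n {0..<n})"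
    unfolding O_set_diag by (rule card_image) (simp add: inj_on_def)
  also have "\<dots> = odd_double_fact n"
    using card_decreasing_forests[of "{0..<n}" n] by (simp add: atLeast0LessThan)
  finally show "o_num n n = odd_double_fact n" by (simp add: o_num_def)
qed

end
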